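(* For every $k\geq 3$, ${}^1\mathsf{TT}^1_k \not\leq_{\mathrm{W}} \mathsf{RT}^1_+$.
   Context: A problem $\mathsf{P}$ is a partial multivalued function from $\omega^\omega$ to $\omega^\omega$ with nonempty solution sets $\mathsf{P}(x)$ on its domain (its instances); objects are coded in $\omega^\omega$ via standard codings, and Turing functionals are identified with their indices. $\mathsf{P} \leq_{\mathrm{W}} \mathsf{Q}$ means there are Turing functionals $\Phi,\Psi$ such that for every instance $x$ of $\mathsf{P}$, $\Phi(x)$ is an instance of $\mathsf{Q}$, and for every $\mathsf{Q}$-solution $y$ of $\Phi(x)$, $\Psi(x\oplus y)$ is a $\mathsf{P}$-solution of $x$. $\mathsf{RT}^1_+$: instances are all pairs $\langle j,g\rangle$ with $j\geq 1$ and $g:\omega\to j$, solutions all infinite $M\subseteq\omega$ on which $g$ is constant. $\mathsf{TT}^1_k$: instances are all $f:2^{<\omega}\to k$, solutions all $H\subseteq 2^{<\omega}$ with $(H,\preceq)$ order-isomorphic to $(2^{<\omega},\preceq)$ ($\preceq$ the prefix order) and $f$ constant on $H$. The first-order part ${}^1\mathsf{P}$ of $\mathsf{P}$ is the problem whose instances are all triples $\langle A,\Delta,\Gamma\rangle$ with $A\in 2^\omega$ and $\Delta,\Gamma$ Turing functionals such that $\Delta(A)$ is an instance of $\mathsf{P}$ and $\Gamma(A\oplus y)(0)$ converges for every $y\in\mathsf{P}(\Delta(A))$; its solutions are all values $\Gamma(A\oplus y)(0)$ for $y\in\mathsf{P}(\Delta(A))$. *)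

theory Defs
  imports "HOL-Library.Nat_Bijection" "HOL-Library.Sublist"
begin

section \<open>Turing functionals\<close>

text \<open>
  Programs for the unary partial functions that are recursive in an oracle. Several
  arguments are packed into one by the Cantor pairing \<^const>\<open>prod_encode\<close>.
\<close>

datatype oprog =
    Zero | Succ | Fst | Snd | Oracle
  | Pair oprog oprog
  | Comp oprog oprog
  | Prec oprog oprog
  | Mu oprog

text \<open>\<open>eval X p n m\<close>: program \<open>p\<close> with oracle \<open>X\<close> converges on input \<open>n\<close> with output \<open>m\<close>.\<close>

inductive eval :: "(nat \<Rightarrow> nat) \<Rightarrow> oprog \<Rightarrow> nat \<Rightarrow> nat \<Rightarrow> bool" for X :: "nat \<Rightarrow> nat" where
  eval_Zero: "eval X Zero n 0"
| eval_Succ: "eval X Succ n (Suc n)"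
| eval_Fst: "eval X Fst (prod_encode (a, b)) a"
| eval_Snd: "eval X Snd (prod_encode (a, b)) b"
| eval_Oracle: "eval X Oracle n (X n)"
| eval_Pair: "eval X p n a \<Longrightarrow> eval X q n b \<Longrightarrow> eval X (Pair p q) n (prod_encode (a, b))"
| eval_Comp: "eval X q n m \<Longrightarrow> eval X p m r \<Longrightarrow> eval X (Comp p q) n r"
| eval_Prec_0: "eval X p a r \<Longrightarrow> eval X (Prec p q) (prod_encode (a, 0)) r"
| eval_Prec_Suc:
    "eval X (Prec p q) (prod_encode (a, n)) s \<Longrightarrow>
     eval X q (prod_encode (a, prod_encode (n, s))) r \<Longrightarrow>
     eval X (Prec p q) (prod_encode (a, Suc n)) r"
| eval_Mu:
    "eval X p (prod_encode (a, n)) 0 \<Longrightarrow>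
     \<forall>i<n. \<exists>v>0. eval X p (prod_encode (a, i)) v \<Longrightarrow>
     eval X (Mu p) a n"

lemma eval_deterministic: "eval X p n m \<Longrightarrow> eval X p n m' \<Longrightarrow> m = m'"
proof (induction arbitrary: m' rule: eval.induct)
  case (eval_Mu p a n)
  from eval_Mu.prems obtain 0: "eval X p (prod_encode (a, m')) 0"
    and pos: "\<forall>i<m'. \<exists>v>0. eval X p (prod_encode (a, i)) v"
    by (cases rule: eval.cases) auto
  show ?case
  proof (rule linorder_cases[of n m'])
    assume "n < m'"
    with pos eval_Mu.IH(1) show ?thesis by fastforce
  next
    assume "m' < n"
    with 0 eval_Mu.IH(2) show ?thesis by fastforce
  qed
next
  case (eval_Pair p n a q b)
  from eval_Pair.prems show ?case
    by (cases rule: eval.cases) (auto dest: eval_Pair.IH)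
next
  case (eval_Comp q n m p r)
  from eval_Comp.prems show ?case
    by (cases rule: eval.cases) (auto dest: eval_Comp.IH)
next
  case (eval_Prec_0 p a r q)
  from eval_Prec_0.prems show ?case
    by (cases rule: eval.cases) (auto dest: eval_Prec_0.IH)
next
  case (eval_Prec_Suc p q a n s r)
  from eval_Prec_Suc.prems show ?case
    by (cases rule: eval.cases) (auto dest: eval_Prec_Suc.IH)
qed (auto elim: eval.cases)

text \<open>A bijective Goedel numbering of the programs, so that every number is an index.\<close>

primrec prog_index :: "oprog \<Rightarrow> nat" where
  "prog_index Zero = 0"
| "prog_index Succ = 1"
| "prog_index Fst = 2"
| "prog_index Snd = 3"
| "prog_index Oracle = 4"
| "prog_index (Pair p q) = 5 + 4 * prod_encode (prog_index p, prog_index q)"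
| "prog_index (Comp p q) = 6 + 4 * prod_encode (prog_index p, prog_index q)"
| "prog_index (Prec p q) = 7 + 4 * prod_encode (prog_index p, prog_index q)"
| "prog_index (Mu p) = 8 + 4 * prog_index p"

lemma bij_prog_index: "bij prog_index"
proof (rule bijI)
  have ne: "4 * a \<noteq> Suc (4 * b)" "4 * a \<noteq> Suc (Suc (4 * b))"
    "4 * a \<noteq> Suc (Suc (Suc (4 * b)))" "4 * a \<noteq> 3 + 4 * b" for a b :: nat
    by presburger+
  show "inj prog_index"
  proof (rule injI)
    fix p q show "prog_index p = prog_index q \<Longrightarrow> p = q"
    proof (induction p arbitrary: q)
      case Zero then show ?case by (cases q) auto
    next
      case Succ then show ?case by (cases q) auto
    next
      case Fst then show ?case by (cases q) auto
    next
      case Snd then show ?case by (cases q) auto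
    next
      case Oracle then show ?case by (cases q) auto
    next
      case (Pair p1 p2) then show ?case by (cases q) (auto simp: ne ne[symmetric])
    next
      case (Comp p1 p2) then show ?case by (cases q) (auto simp: ne ne[symmetric])
    next
      case (Prec p1 p2) then show ?case by (cases q) (auto simp: ne ne[symmetric])
    next
      case (Mu p) then show ?case by (cases q) (auto simp: ne ne[symmetric])
    qed
  qed
  have "\<exists>p. prog_index p = n" for n
  proof (induction n rule: less_induct)
    case (less n)
    show ?case
    proof (cases "n < 5")
      case True
      then have "n = 0 \<or> n = 1 \<or> n = 2 \<or> n = 3 \<or> n = 4" by auto
      then show ?thesis by (metis prog_index.simps(1-5))
    next
      case False
      define m where "m = (n - 5) div 4"
      obtain a b where m: "m = prod_encode (a, b)"
        by (metis prod_decode_inverse surj_pair)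
      have "m < n" using False by (simp add: m_def)
      moreover have "a \<le> m" "b \<le> m"
        by (simp_all add: m le_prod_encode_1 le_prod_encode_2)
      ultimately obtain p q r where "prog_index p = a" "prog_index q = b" "prog_index r = m"
        by (meson less order.strict_trans1)
      moreover have "n = 5 + 4 * m \<or> n = 6 + 4 * m \<or> n = 7 + 4 * m \<or> n = 8 + 4 * m"
        using False unfolding m_def by presburger
      ultimately show ?thesis
        using m by (metis prog_index.simps(6-9))
    qed
  qed
  then show "surj prog_index" by (metis surjI)
qed

text \<open>\<open>converges e X n m\<close>: the value at \<open>n\<close> of the functional with index \<open>e\<close>, applied to
  \<open>X\<close>, is defined and equals \<open>m\<close>.\<close>

definition converges :: "nat \<Rightarrow> (nat \<Rightarrow> nat) \<Rightarrow> nat \<Rightarrow> nat \<Rightarrow> bool" where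
  "converges e X n m \<longleftrightarrow> eval X (inv prog_index e) n m"

definition maps_to :: "nat \<Rightarrow> (nat \<Rightarrow> nat) \<Rightarrow> (nat \<Rightarrow> nat) \<Rightarrow> bool" where
  "maps_to e X Y \<longleftrightarrow> (\<forall>n. converges e X n (Y n))"

lemma maps_to_unique: "maps_to e X Y \<Longrightarrow> maps_to e X Z \<Longrightarrow> Y = Z"
  unfolding maps_to_def converges_def by (metis ext eval_deterministic)


section \<open>Codings into Baire space\<close>

definition join :: "(nat \<Rightarrow> nat) \<Rightarrow> (nat \<Rightarrow> nat) \<Rightarrow> nat \<Rightarrow> nat"  (infixl \<open>\<oplus>\<close> 65) where
  "x \<oplus> y = (\<lambda>n. if even n then x (n div 2) else y (n div 2))"

text \<open>A number paired with a function is coded by prepending the number (\<^term>\<open>case_nat j g\<close>);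
  a number on its own is coded by the constant function.\<close>

definition const_seq :: "nat \<Rightarrow> nat \<Rightarrow> nat" where
  "const_seq v = (\<lambda>_. v)"

definition triple :: "(nat \<Rightarrow> nat) \<Rightarrow> nat \<Rightarrow> nat \<Rightarrow> nat \<Rightarrow> nat" where
  "triple A d g = case_nat d (case_nat g A)"

definition char_fun :: "nat set \<Rightarrow> nat \<Rightarrow> nat" where
  "char_fun M = (\<lambda>n. of_bool (n \<in> M))"

text \<open>The position of a binary string in the length-lexicographic enumeration.\<close>

definition str_code :: "bool list \<Rightarrow> nat" where
  "str_code \<sigma> = foldl (\<lambda>n b. 2 * n + 1 + of_bool b) 0 \<sigma>"

lemma str_code_Nil [simp]: "str_code [] = 0"
  and str_code_snoc [simp]: "str_code (\<sigma> @ [b]) = 2 * str_code \<sigma> + 1 + of_bool b"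
  by (simp_all add: str_code_def)

lemma bij_str_code: "bij str_code"
proof (rule bijI)
  show "inj str_code"
  proof (rule injI)
    fix \<sigma> \<tau> show "str_code \<sigma> = str_code \<tau> \<Longrightarrow> \<sigma> = \<tau>"
    proof (induction \<sigma> arbitrary: \<tau> rule: rev_induct)
      case Nil then show ?case by (cases \<tau> rule: rev_cases) auto
    next
      case (snoc b \<sigma>)
      obtain \<tau>' b' where \<tau>: "\<tau> = \<tau>' @ [b']"
        using snoc.prems by (cases \<tau> rule: rev_cases) auto
      with snoc.prems have eq: "2 * str_code \<sigma> + of_bool b = 2 * str_code \<tau>' + of_bool b'"
        by simp
      then have "(2 * str_code \<sigma> + of_bool b) mod 2 = (2 * str_code \<tau>' + of_bool b') mod 2"
        by (rule arg_cong)
      then have "b = b'" by (cases b; cases b') auto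
      with eq snoc.IH \<tau> show ?case by simp
    qed
  qed
  have "\<exists>\<sigma>. str_code \<sigma> = n" for n
  proof (induction n rule: less_induct)
    case (less n)
    show ?case
    proof (cases n)
      case 0 then show ?thesis by (metis str_code_Nil)
    next
      case (Suc m)
      then obtain \<sigma> where "str_code \<sigma> = m div 2" using less[of "m div 2"]
        by (auto simp: less_Suc_eq_le)
      then have "str_code (\<sigma> @ [odd m]) = n" using Suc by simp
      then show ?thesis ..
    qed
  qed
  then show "surj str_code" by (metis surjI)
qed


section \<open>Problems and Weihrauch reducibility\<close>

text \<open>A problem is a pair as below in which every instance has a solution; for the problems
  used here this is proved after their definitions.\<close>

record problem =
  instances :: "(nat \<Rightarrow> nat) set"
  solutions :: "(nat \<Rightarrow> nat) \<Rightarrow> (nat \<Rightarrow> nat) set"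

definition weihrauch_le :: "problem \<Rightarrow> problem \<Rightarrow> bool"  (infix \<open>\<le>\<^sub>W\<close> 50) where
  "P \<le>\<^sub>W Q \<longleftrightarrow>
     (\<exists>\<Phi> \<Psi>. \<forall>x \<in> instances P. \<exists>z \<in> instances Q. maps_to \<Phi> x z \<and>
        (\<forall>y \<in> solutions Q z. \<exists>w \<in> solutions P x. maps_to \<Psi> (x \<oplus> y) w))"

definition RT1_plus :: problem where
  "RT1_plus =
     \<lparr>instances = {case_nat j g |j g. 1 \<le> j \<and> (\<forall>n. g n < j)},
      solutions = (\<lambda>x. {char_fun M |M. infinite M \<and> (\<exists>c. \<forall>n\<in>M. x (Suc n) = c)})\<rparr>"

definition perfect_subtree :: "bool list set \<Rightarrow> bool" where
  "perfect_subtree H \<longleftrightarrow>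
     (\<exists>h :: bool list \<Rightarrow> bool list. bij_betw h UNIV H \<and> (\<forall>\<sigma> \<tau>. prefix (h \<sigma>) (h \<tau>) \<longleftrightarrow> prefix \<sigma> \<tau>))"

text \<open>Since \<^const>\<open>str_code\<close> is bijective, every \<open>x\<close> codes the unique function \<open>x \<circ> str_code\<close>
  on strings.\<close>

definition TT1 :: "nat \<Rightarrow> problem" where
  "TT1 k =
     \<lparr>instances = {x. \<forall>\<sigma>. x (str_code \<sigma>) < k},
      solutions = (\<lambda>x. {char_fun (str_code ` H) |H.
        perfect_subtree H \<and> (\<exists>c. \<forall>\<sigma>\<in>H. x (str_code \<sigma>) = c)})\<rparr>"

definition first_order_part :: "problem \<Rightarrow> problem" where
  "first_order_part P =
     \<lparr>instances = {triple A \<Delta> \<Gamma> |A \<Delta> \<Gamma>.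
        range A \<subseteq> {0, 1} \<and>
        (\<exists>z \<in> instances P. maps_to \<Delta> A z \<and>
           (\<forall>y \<in> solutions P z. \<exists>v. converges \<Gamma> (A \<oplus> y) 0 v))},
      solutions = (\<lambda>x. {const_seq v |v. \<exists>A \<Delta> \<Gamma> z y.
        x = triple A \<Delta> \<Gamma> \<and> maps_to \<Delta> A z \<and> y \<in> solutions P z \<and>
        converges \<Gamma> (A \<oplus> y) 0 v})\<rparr>"

lemma RT1_plus_solvable:
  assumes "x \<in> instances RT1_plus"
  shows "solutions RT1_plus x \<noteq> {}"
proof -
  from assms obtain j g where x: "x = case_nat j g" and g: "\<forall>n. g n < j"
    by (auto simp: RT1_plus_def)
  have "finite (range g)"
    by (rule finite_subset[of _ "{..<j}"]) (use g in auto)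
  then obtain m where "infinite {n. g n = g m}"
    using pigeonhole_infinite[of UNIV g] by auto
  then have "char_fun {n. g n = g m} \<in> solutions RT1_plus x"
    by (auto simp: RT1_plus_def x)
  then show ?thesis by blast
qed

lemma dense_color:
  fixes f :: "bool list \<Rightarrow> nat"
  assumes "\<forall>\<sigma>. f \<sigma> < k"
  shows "\<exists>c \<sigma>. \<forall>\<tau>. prefix \<sigma> \<tau> \<longrightarrow> (\<exists>\<rho>. prefix \<tau> \<rho> \<and> f \<rho> = c)"
proof (rule ccontr)
  assume neg: "\<not> ?thesis"
  have "\<exists>\<tau>. \<forall>\<rho>. prefix \<tau> \<rho> \<longrightarrow> f \<rho> \<ge> m" for m
  proof (induction m)
    case (Suc m)
    then obtain \<tau> where \<tau>: "\<forall>\<rho>. prefix \<tau> \<rho> \<longrightarrow> f \<rho> \<ge> m" by blast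
    from neg obtain \<tau>' where "prefix \<tau> \<tau>'" "\<forall>\<rho>. prefix \<tau>' \<rho> \<longrightarrow> f \<rho> \<noteq> m" by blast
    with \<tau> have "\<forall>\<rho>. prefix \<tau>' \<rho> \<longrightarrow> f \<rho> \<ge> Suc m"
      by (metis Suc_leI le_neq_implies_less prefix_order.order_trans)
    then show ?case ..
  qed simp
  with assms show False by (metis leD prefix_order.order_refl)
qed

lemma perfect_subtree_range:
  fixes h :: "bool list \<Rightarrow> bool list"
  assumes step: "\<And>\<sigma> b. prefix (h \<sigma> @ [b]) (h (\<sigma> @ [b]))"
  shows "perfect_subtree (range h)"
proof -
  have mono: "prefix (h \<sigma>) (h (\<sigma> @ \<rho>))" for \<sigma> \<rho>
  proof (induction \<rho> rule: rev_induct)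
    case (snoc b \<rho>)
    with step[of "\<sigma> @ \<rho>" b] show ?case
      by (metis append.assoc append_prefixD prefix_order.order_trans)
  qed simp
  have sym: "prefix (h \<sigma> @ [b]) (h (\<sigma> @ b # \<rho>))" for \<sigma> b \<rho>
    using step[of \<sigma> b] mono[of "\<sigma> @ [b]" \<rho>] by (simp add: prefix_order.order_trans)
  have emb: "prefix \<sigma> \<tau>" if "prefix (h \<sigma>) (h \<tau>)" for \<sigma> \<tau>
  proof (rule ccontr)
    assume np: "\<not> prefix \<sigma> \<tau>"
    show False
    proof (cases "prefix \<tau> \<sigma>")
      case True
      with np obtain b \<rho> where "\<sigma> = \<tau> @ b # \<rho>"
        by (metis append_Nil2 neq_Nil_conv prefixE prefix_order.order_refl)
      with sym[of \<tau> b \<rho>] that show False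
        by (metis not_Cons_self2 prefix_order.antisym append_prefixD same_prefix_nil)
    next
      case False
      with np have "\<sigma> \<parallel> \<tau>" by (simp add: parallel_def)
      then obtain \<pi> a \<alpha> b \<beta> where ab: "a \<noteq> b" "\<sigma> = \<pi> @ a # \<alpha>" "\<tau> = \<pi> @ b # \<beta>"
        using parallel_decomp[of \<sigma> \<tau>] by (auto simp: neq_commute)
      then have "prefix (h \<pi> @ [a]) (h \<tau>)" "prefix (h \<pi> @ [b]) (h \<tau>)"
        using sym[of \<pi> a \<alpha>] sym[of \<pi> b \<beta>] that
        by - (metis prefix_order.order_trans, simp)
      with ab(1) show False by (auto simp: prefix_def)
    qed
  qed
  have iff: "prefix (h \<sigma>) (h \<tau>) \<longleftrightarrow> prefix \<sigma> \<tau>" for \<sigma> \<tau>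
    by (metis emb mono prefixE)
  then have "inj h"
    by (metis injI prefix_order.antisym prefix_order.order_refl)
  with iff show ?thesis
    unfolding perfect_subtree_def by (intro exI[of _ h]) (auto simp: bij_betw_def)
qed

lemma TT1_solvable:
  assumes "x \<in> instances (TT1 k)"
  shows "solutions (TT1 k) x \<noteq> {}"
proof -
  let ?f = "\<lambda>\<sigma>. x (str_code \<sigma>)"
  from assms have "\<forall>\<sigma>. ?f \<sigma> < k" by (simp add: TT1_def)
  from dense_color[OF this] obtain c \<sigma>0 where
    "\<forall>\<tau>. prefix \<sigma>0 \<tau> \<longrightarrow> (\<exists>\<rho>. prefix \<tau> \<rho> \<and> ?f \<rho> = c)" by blast
  then obtain e where e: "\<And>\<tau>. prefix \<sigma>0 \<tau> \<Longrightarrow> prefix \<tau> (e \<tau>) \<and> ?f (e \<tau>) = c" by metis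
  define h where "h \<sigma> = foldl (\<lambda>\<tau> b. e (\<tau> @ [b])) (e \<sigma>0) \<sigma>" for \<sigma>
  have h: "prefix \<sigma>0 (h \<sigma>) \<and> ?f (h \<sigma>) = c" for \<sigma>
  proof (induction \<sigma> rule: rev_induct)
    case Nil then show ?case using e[of \<sigma>0] by (simp add: h_def)
  next
    case (snoc b \<sigma>)
    then have "prefix \<sigma>0 (h \<sigma> @ [b])" by simp
    from e[OF this] this have "prefix \<sigma>0 (e (h \<sigma> @ [b])) \<and> ?f (e (h \<sigma> @ [b])) = c"
      by (metis prefix_order.order_trans)
    then show ?case by (simp add: h_def)
  qed
  have "prefix (h \<sigma> @ [b]) (h (\<sigma> @ [b]))" for \<sigma> b
    using e[of "h \<sigma> @ [b]"] h[of \<sigma>] by (simp add: h_def)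
  then have "perfect_subtree (range h)" by (rule perfect_subtree_range)
  with h have "char_fun (str_code ` range h) \<in> solutions (TT1 k) x"
    by (auto simp: TT1_def)
  then show ?thesis by blast
qed

lemma first_order_part_solvable:
  assumes "\<And>x. x \<in> instances P \<Longrightarrow> solutions P x \<noteq> {}"
    and "x \<in> instances (first_order_part P)"
  shows "solutions (first_order_part P) x \<noteq> {}"
proof -
  from assms(2) obtain A \<Delta> \<Gamma> z where x: "x = triple A \<Delta> \<Gamma>" "z \<in> instances P" "maps_to \<Delta> A z"
    and conv: "\<forall>y \<in> solutions P z. \<exists>v. converges \<Gamma> (A \<oplus> y) 0 v"
    by (auto simp: first_order_part_def)
  from assms(1) x(2) obtain y where y: "y \<in> solutions P z" by blast
  with conv obtain v where "converges \<Gamma> (A \<oplus> y) 0 v" by blast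
  with x y have "const_seq v \<in> solutions (first_order_part P) x"
    unfolding first_order_part_def by (simp only: problem.simps mem_Collect_eq) blast
  then show ?thesis by blast
qed

end

(* A solver that reads only finitely much of its input announces the number j of columns of the
   RT^1_+ instance while the coloring f still looks constantly 0. A solver commits to one
   guess per column, and the guess of every infinite column must be correct, so it suffices to
   extend f so as to refute up to j guesses at once. The functional Gamma waits for an initial
   segment of H that contains a point of color 0 or an antichain of size s, where s is the first
   position of f of nonzero color, and outputs that segment; we make s >= j. From then on f
   avoids color 0, which refutes guesses of color 0. The remaining guesses contain at most j
   antichains of size at least j, which have pairwise incomparable representatives; above the
   representative of color i in {1, 2} only the other color of {1, 2} is used. *)
theory Submission
  imports Defs
begin

section \<open>Continuity of Turing functionals\<close>

lemma eval_continuous: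
  "eval X p n m \<Longrightarrow> \<exists>U. \<forall>Y. (\<forall>i<U. Y i = X i) \<longrightarrow> eval Y p n m"
proof (induction rule: eval.induct)
  case (eval_Oracle n)
  show ?case by (rule exI[of _ "Suc n"]) (metis eval.eval_Oracle lessI)
next
  case (eval_Pair p n a q b)
  then obtain U V where "\<forall>Y. (\<forall>i<U. Y i = X i) \<longrightarrow> eval Y p n a"
    "\<forall>Y. (\<forall>i<V. Y i = X i) \<longrightarrow> eval Y q n b" by blast
  then show ?case by (intro exI[of _ "max U V"]) (auto intro!: eval.intros)
next
  case (eval_Comp q n m p r)
  then obtain U V where "\<forall>Y. (\<forall>i<U. Y i = X i) \<longrightarrow> eval Y q n m"
    "\<forall>Y. (\<forall>i<V. Y i = X i) \<longrightarrow> eval Y p m r" by blast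
  then show ?case
    by (intro exI[of _ "max U V"] allI impI) (rule eval.eval_Comp[of _ _ _ m], auto)
next
  case (eval_Prec_0 p a r q)
  then show ?case by (meson eval.eval_Prec_0)
next
  case (eval_Prec_Suc p q a n s r)
  then obtain U V where "\<forall>Y. (\<forall>i<U. Y i = X i) \<longrightarrow> eval Y (Prec p q) (prod_encode (a, n)) s"
    "\<forall>Y. (\<forall>i<V. Y i = X i) \<longrightarrow> eval Y q (prod_encode (a, prod_encode (n, s))) r" by blast
  then show ?case
    by (intro exI[of _ "max U V"] allI impI) (rule eval.eval_Prec_Suc[of _ _ _ _ _ s], auto)
next
  case (eval_Mu p a n)
  then obtain U where U: "\<forall>Y. (\<forall>i<U. Y i = X i) \<longrightarrow> eval Y p (prod_encode (a, n)) 0" by blast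
  have "\<forall>i. \<exists>V. i < n \<longrightarrow>
      (\<exists>v>0. \<forall>Y. (\<forall>i<V. Y i = X i) \<longrightarrow> eval Y p (prod_encode (a, i)) v)"
    using eval_Mu.IH(2) by blast
  then obtain V where V: "\<And>i. i < n \<Longrightarrow>
      (\<exists>v>0. \<forall>Y. (\<forall>j<V i. Y j = X j) \<longrightarrow> eval Y p (prod_encode (a, i)) v)"
    by metis
  \<comment> \<open>The search reads the oracle only in its successful test and in the
    \<open>n\<close> failed ones before it. Including \<open>U\<close> also keeps the set nonempty
    for \<open>n = 0\<close>.\<close>
  define M where "M = Max (insert U (V ` {..<n}))"
  have M: "U \<le> M" "i < n \<Longrightarrow> V i \<le> M" for i
    by (simp_all add: M_def)
  show ?case
  proof (intro exI[of _ M] allI impI)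
    fix Y assume Y: "\<forall>i<M. Y i = X i"
    show "eval Y (Mu p) a n"
    proof (rule eval.eval_Mu)
      show "eval Y p (prod_encode (a, n)) 0" using U Y M(1) by auto
      show "\<forall>i<n. \<exists>v>0. eval Y p (prod_encode (a, i)) v"
        using V Y M(2) by (meson order.strict_trans2)
    qed
  qed
qed (auto intro: eval.intros)

lemma converges_continuous:
  assumes "converges e X n m"
  obtains U where "\<And>Y. (\<And>i. i < U \<Longrightarrow> Y i = X i) \<Longrightarrow> converges e Y n m"
  using eval_continuous assms unfolding converges_def by metis

lemma converges_deterministic: "converges e X n m \<Longrightarrow> converges e X n m' \<Longrightarrow> m = m'"
  unfolding converges_def by (rule eval_deterministic)

lemma converges_index [simp]: "converges (prog_index p) X n m \<longleftrightarrow> eval X p n m"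
  by (simp add: converges_def bij_is_inj[OF bij_prog_index])

lemma maps_to_continuous:
  assumes "maps_to e X Z"
  obtains U where "\<And>Y n. (\<And>i. i < U \<Longrightarrow> Y i = X i) \<Longrightarrow> n < N \<Longrightarrow> converges e Y n (Z n)"
proof -
  have "\<exists>U. \<forall>Y. (\<forall>i<U. Y i = X i) \<longrightarrow> converges e Y n (Z n)" for n
    using assms converges_continuous unfolding maps_to_def by metis
  then obtain U where U: "\<And>n Y. \<forall>i<U n. Y i = X i \<Longrightarrow> converges e Y n (Z n)" by metis
  \<comment> \<open>For \<open>N = 0\<close> this maximum is unspecified, but then there is no
    \<open>n < N\<close>.\<close>
  have "converges e Y n (Z n)" if "\<And>i. i < Max (U ` {..<N}) \<Longrightarrow> Y i = X i" "n < N" for Y n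
  proof -
    have "U n \<le> Max (U ` {..<N})" using that(2) by simp
    with U that(1) show ?thesis by simp
  qed
  then show thesis using that by blast
qed


section \<open>Antichains of strings\<close>

text \<open>A longest string \<open>x\<close> of the union can represent its own class. In every
  other antichain the strings comparable with \<open>x\<close> are prefixes of \<open>x\<close>,
  hence comparable with each other, so discarding them costs at most one string. One class is gone
  as well, and the induction continues.\<close>

lemma incomparable_representatives:
  fixes F :: "'i \<Rightarrow> 'a list set"
  assumes "finite C"
    and "\<And>c. c \<in> C \<Longrightarrow> finite (F c) \<and> pairwise (\<parallel>) (F c) \<and> card C \<le> card (F c)"
  shows "\<exists>r. (\<forall>c\<in>C. r c \<in> F c) \<and> pairwise (\<lambda>c d. r c \<parallel> r d) C"
  using assms
proof (induction "card C" arbitrary: C F)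
  case 0
  then show ?case by simp
next
  case (Suc n)
  let ?U = "\<Union>c\<in>C. F c"
  have "C \<noteq> {}" using Suc.hyps(2) by auto
  then have "finite ?U" "?U \<noteq> {}"
    using Suc.prems Suc.hyps(2) by fastforce+
  then have "Max (length ` ?U) \<in> length ` ?U" by (intro Max_in) auto
  then obtain x where "x \<in> ?U" "length x = Max (length ` ?U)" by (metis (no_types, lifting) imageE)
  with \<open>finite ?U\<close> have x: "x \<in> ?U" "\<And>y. y \<in> ?U \<Longrightarrow> length y \<le> length x"
    by (simp_all only: Max_ge finite_imageI imageI)
  then obtain c where c: "c \<in> C" "x \<in> F c" by blast
  define G where "G d = {\<sigma> \<in> F d. \<sigma> \<parallel> x}" for d
  have "finite (G d) \<and> pairwise (\<parallel>) (G d) \<and> card (C - {c}) \<le> card (G d)" if d: "d \<in> C - {c}" for d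
  proof -
    have F: "finite (F d)" "pairwise (\<parallel>) (F d)" "Suc n \<le> card (F d)"
      using Suc.prems Suc.hyps(2) d by auto
    have pre: "prefix \<sigma> x" if "\<sigma> \<in> F d - G d" for \<sigma>
    proof -
      have "length \<sigma> \<le> length x" using x(2) that d by blast
      with that show ?thesis
        by (auto simp: G_def parallel_def) (metis not_equal_is_parallel order.antisym parallelE prefix_length_le)
    qed
    have "card (F d - G d) \<le> Suc 0"
    proof (rule card_le_Suc0_iff_eq[THEN iffD2])
      show "\<forall>a\<in>F d - G d. \<forall>b\<in>F d - G d. a = b"
        using pre F(2) by (metis DiffD1 pairwiseD parallelE prefix_same_cases)
    qed (use F in simp)
    moreover have "card (F d - G d) = card (F d) - card (G d)"
      using F(1) by (intro card_Diff_subset) (auto simp: G_def)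
    ultimately have "n \<le> card (G d)" using F(3) by linarith
    then show ?thesis
      using F c Suc.hyps(2) Suc.prems(1) by (auto simp: G_def pairwise_def)
  qed
  moreover have "n = card (C - {c})" "finite (C - {c})"
    using Suc.hyps(2) Suc.prems(1) c by auto
  ultimately obtain r where r: "\<forall>d\<in>C-{c}. r d \<in> G d" "pairwise (\<lambda>c d. r c \<parallel> r d) (C - {c})"
    using Suc.hyps(1)[of "C - {c}" G] by blast
  let ?r = "r(c := x)"
  have "\<forall>d\<in>C. ?r d \<in> F d" using r(1) c by (auto simp: G_def)
  moreover have "pairwise (\<lambda>c d. ?r c \<parallel> ?r d) C"
    using r by (auto simp: pairwise_def G_def dest: parallel_commute[THEN iffD1])
  ultimately show ?case by blast
qed

text \<open>A level of the full binary tree is an antichain of 2^n strings, and order embeddings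
  preserve incomparability.\<close>

lemma perfect_subtree_antichain:
  assumes "perfect_subtree H"
  obtains F where "F \<subseteq> H" "finite F" "pairwise (\<parallel>) F" "n \<le> card F"
proof -
  from assms obtain h :: "bool list \<Rightarrow> bool list" where
    h: "bij_betw h UNIV H" "\<And>\<sigma> \<tau>. prefix (h \<sigma>) (h \<tau>) \<longleftrightarrow> prefix \<sigma> \<tau>"
    by (auto simp: perfect_subtree_def)
  let ?L = "{\<sigma> :: bool list. length \<sigma> = n}"
  have L: "finite ?L" "card ?L = 2 ^ n"
    using finite_lists_length_eq[of "UNIV :: bool set" n] card_lists_length_eq[of "UNIV :: bool set" n]
    by auto
  have "inj h" using h(1) by (simp add: bij_betw_def)
  then have "card (h ` ?L) = 2 ^ n" using L(2) by (metis card_image inj_on_subset subset_UNIV)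
  moreover have "pairwise (\<parallel>) (h ` ?L)"
    by (auto simp: pairwise_def parallel_def h(2)) (metis not_equal_is_parallel parallelE)+
  moreover have "h ` ?L \<subseteq> H" using h(1) by (auto simp: bij_betw_def)
  ultimately show thesis
    using that[of "h ` ?L"] L(1) by (metis finite_imageI less_exp less_imp_le)
qed

lemma perfect_subtree_infinite_above:
  assumes "perfect_subtree H" "\<sigma> \<in> H"
  shows "infinite {\<tau> \<in> H. prefix \<sigma> \<tau>}"
proof -
  from assms obtain h :: "bool list \<Rightarrow> bool list" and \<rho> where
    h: "bij_betw h UNIV H" "\<And>\<sigma> \<tau>. prefix (h \<sigma>) (h \<tau>) \<longleftrightarrow> prefix \<sigma> \<tau>" "\<sigma> = h \<rho>"
    by (auto simp: perfect_subtree_def bij_betw_def)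
  \<comment> \<open>A single branch above \<open>\<rho>\<close> in the full tree is enough.\<close>
  let ?e = "\<lambda>n. h (\<rho> @ replicate n False)"
  have "inj h" using h(1) by (simp add: bij_betw_def)
  then have "inj ?e" by (intro injI) (simp add: inj_eq)
  then have "infinite (range ?e)" using finite_imageD infinite_UNIV_nat by blast
  moreover have "range ?e \<subseteq> {\<tau> \<in> H. prefix \<sigma> \<tau>}"
    using h by (auto simp: bij_betw_def)
  ultimately show ?thesis by (metis finite_subset)
qed

lemma perfect_subtree_nonempty: "perfect_subtree H \<Longrightarrow> H \<noteq> {}"
  by (auto simp: perfect_subtree_def bij_betw_def)

lemma infinite_strings_above_code:
  assumes "infinite S"
  obtains \<sigma> where "\<sigma> \<in> S" "N \<le> str_code \<sigma>"
proof -
  have "infinite (str_code ` S)"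
    using assms bij_str_code by (metis bij_is_inj finite_imageD inj_on_subset subset_UNIV)
  then show thesis using that by (metis finite_nat_set_iff_bounded imageE not_le)
qed


section \<open>The instances\<close>

definition segment_set :: "nat list \<Rightarrow> bool list set" where
  "segment_set l = {\<sigma>. str_code \<sigma> < length l \<and> l ! str_code \<sigma> = 1}"

text \<open>The stopping condition of the search. The bound on \<open>s\<close> makes it depend only
  on the values of \<open>f\<close> below \<open>length l\<close>.\<close>

definition sufficient :: "(nat \<Rightarrow> nat) \<Rightarrow> nat list \<Rightarrow> bool" where
  "sufficient f l \<longleftrightarrow>
     (\<exists>\<sigma> \<in> segment_set l. f (str_code \<sigma>) = 0) \<or>
     (\<exists>s < length l. f s \<noteq> 0 \<and> (\<forall>t<s. f t = 0) \<and>
        (\<exists>F \<subseteq> segment_set l. pairwise (\<parallel>) F \<and> s \<le> card F))"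

text \<open>Column \<open>a\<close> holds the color \<open>f a\<close> in unary at the positions below 3. The remaining positions
  decide \<^const>\<open>sufficient\<close> for the initial segment with code \<open>a\<close>, which spares the functional
  any computation with antichains; since this depends only on \<open>f\<close> below \<open>a\<close>, the oracle
  depends continuously on \<open>f\<close>. Segments are coded in reverse so that they can be built by
  primitive recursion.\<close>

definition coloring_oracle :: "(nat \<Rightarrow> nat) \<Rightarrow> nat \<Rightarrow> nat" where
  "coloring_oracle f p = (case prod_decode p of (a, i) \<Rightarrow>
     if i < 3 then of_bool (i < f a) else of_bool (\<not> sufficient f (rev (list_decode a))))"

lemma finite_segment_set: "finite (segment_set l)"
proof -
  have "segment_set l = str_code -` {n. n < length l \<and> l ! n = 1}"
    by (auto simp: segment_set_def)
  then show ?thesis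
    by (metis (mono_tags, lifting) bij_is_inj bij_str_code finite_nat_set_iff_bounded finite_vimageI mem_Collect_eq)
qed

lemma length_le_list_encode: "length l \<le> list_encode l"
proof (induction l)
  case (Cons x l)
  then show ?case using le_prod_encode_2[of "list_encode l" x] by simp
qed simp

lemma sufficient_cong:
  assumes "\<And>i. i < length l \<Longrightarrow> f i = g i" shows "sufficient f l = sufficient g l"
proof -
  have "(\<exists>\<sigma> \<in> segment_set l. f (str_code \<sigma>) = 0) = (\<exists>\<sigma> \<in> segment_set l. g (str_code \<sigma>) = 0)"
    by (rule bex_cong) (auto simp: segment_set_def assms)
  moreover have "(f s \<noteq> 0 \<and> (\<forall>t<s. f t = 0)) = (g s \<noteq> 0 \<and> (\<forall>t<s. g t = 0))" if "s < length l" for s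
    using that assms by (metis order.strict_trans)
  ultimately show ?thesis unfolding sufficient_def by blast
qed

text \<open>Position \<open>p\<close> lies in a column \<open>a <= p\<close>, and the segment coded
  by \<open>a\<close> has length at most \<open>a\<close>.\<close>

lemma coloring_oracle_cong:
  assumes "\<And>i. i \<le> p \<Longrightarrow> f i = g i"
  shows "coloring_oracle f p = coloring_oracle g p"
proof -
  obtain a i where p: "p = prod_encode (a, i)" by (metis prod_decode_inverse surj_pair)
  have "a \<le> p" by (simp add: p le_prod_encode_1)
  moreover have "length (list_decode a) \<le> a"
    using length_le_list_encode[of "list_decode a"] by simp
  ultimately have "f a = g a" "sufficient f (rev (list_decode a)) = sufficient g (rev (list_decode a))"
    by (auto intro!: assms sufficient_cong)
  then show ?thesis by (simp add: coloring_oracle_def p)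
qed

section \<open>Programs for the two functionals\<close>

definition lookup_prog :: oprog where
  "lookup_prog = Mu Oracle"

text \<open>This is the address computation for joins: entry \<open>m\<close> of the left part sits
  at \<open>2 * m\<close>, that of the right part one place later.\<close>

definition double_prog :: "oprog \<Rightarrow> oprog" where
  "double_prog p = Comp (Prec Zero (Comp Succ (Comp Succ (Comp Snd Snd)))) (Pair Zero p)"

text \<open>The code of a cons is the successor of a pair, so each recursion step puts the next
  value of the right part in front.\<close>

definition segment_prog :: oprog where
  "segment_prog = Prec Zero (Comp Succ
     (Pair (Comp Oracle (Comp Succ (double_prog (Comp Fst Snd)))) (Comp Snd Snd)))"

text \<open>Position 3 is the first one in a column past the unary color. The negated bit there
  supplies the 0 on which \<open>Mu\<close> stops.\<close>

definition test_prog :: oprog where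
  "test_prog = Comp Oracle (double_prog (Pair segment_prog (Comp Succ (Comp Succ (Comp Succ Zero)))))"

definition search_prog :: oprog where
  "search_prog = Comp segment_prog (Pair Zero (Mu test_prog))"

lemma eval_double_prog:
  assumes "eval X p n m" shows "eval X (double_prog p) n (2 * m)"
proof -
  have "eval X (Prec Zero (Comp Succ (Comp Succ (Comp Snd Snd)))) (prod_encode (0, m)) (2 * m)" for m
  proof (induction m)
    case (Suc m)
    have "eval X (Comp Succ (Comp Succ (Comp Snd Snd)))
        (prod_encode (0, prod_encode (m, 2 * m))) (Suc (Suc (2 * m)))"
      by (rule eval.intros)+
    with Suc show ?case by (auto intro: eval.intros)
  qed (auto intro: eval.intros)
  then show ?thesis
    unfolding double_prog_def using assms by (meson eval.intros)
qed

lemma eval_segment_prog: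
  "eval (x \<oplus> y) segment_prog (prod_encode (a, n)) (list_encode (rev (map y [0..<n])))"
proof (induction n)
  case 0
  then show ?case by (auto simp: segment_prog_def intro: eval.intros)
next
  case (Suc n)
  define s where "s = list_encode (rev (map y [0..<n]))"
  let ?i = "prod_encode (a, prod_encode (n, s))"
  have "eval (x \<oplus> y) (double_prog (Comp Fst Snd)) ?i (2 * n)"
    by (rule eval_double_prog eval.intros)+
  then have "eval (x \<oplus> y) (Comp Oracle (Comp Succ (double_prog (Comp Fst Snd)))) ?i ((x \<oplus> y) (Suc (2 * n)))"
    by (rule eval.eval_Comp[OF eval.eval_Comp[OF _ eval.eval_Succ] eval.eval_Oracle])
  moreover have "(x \<oplus> y) (Suc (2 * n)) = y n" by (simp add: join_def)
  ultimately have "eval (x \<oplus> y) (Comp Succ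
     (Pair (Comp Oracle (Comp Succ (double_prog (Comp Fst Snd)))) (Comp Snd Snd))) ?i
     (Suc (prod_encode (y n, s)))"
    by (metis eval.eval_Comp eval.eval_Pair eval.eval_Snd eval.eval_Succ)
  with Suc show ?case
    unfolding segment_prog_def s_def by (auto intro: eval.eval_Prec_Suc)
qed

lemma eval_test_prog:
  "eval (coloring_oracle f \<oplus> y) test_prog (prod_encode (a, n))
     (of_bool (\<not> sufficient f (map y [0..<n])))"
proof -
  let ?w = "list_encode (rev (map y [0..<n]))" and ?X = "coloring_oracle f \<oplus> y"
  have "eval ?X (Comp Succ (Comp Succ (Comp Succ Zero))) (prod_encode (a, n)) (Suc (Suc (Suc 0)))"
    by (rule eval.intros)+
  then have "eval ?X (double_prog (Pair segment_prog (Comp Succ (Comp Succ (Comp Succ Zero)))))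
      (prod_encode (a, n)) (2 * prod_encode (?w, 3))"
    unfolding numeral_3_eq_3 by (intro eval_double_prog eval.eval_Pair eval_segment_prog)
  then have "eval ?X test_prog (prod_encode (a, n)) (?X (2 * prod_encode (?w, 3)))"
    unfolding test_prog_def by (rule eval.eval_Comp) (rule eval.eval_Oracle)
  then show ?thesis by (simp add: join_def coloring_oracle_def)
qed

lemma eval_search_prog:
  assumes "sufficient f (map y [0..<n])"
  obtains m where "sufficient f (map y [0..<m])"
    "eval (coloring_oracle f \<oplus> y) search_prog 0 (list_encode (rev (map y [0..<m])))"
proof -
  define m where "m = (LEAST m. sufficient f (map y [0..<m]))"
  have m: "sufficient f (map y [0..<m])" "\<And>i. i < m \<Longrightarrow> \<not> sufficient f (map y [0..<i])"
    using assms by (auto simp: m_def intro: LeastI dest: not_less_Least)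
  have "eval (coloring_oracle f \<oplus> y) (Mu test_prog) 0 m"
  proof (rule eval.eval_Mu)
    show "eval (coloring_oracle f \<oplus> y) test_prog (prod_encode (0, m)) 0"
      using eval_test_prog[of f y 0 m] m(1) by simp
    show "\<forall>i<m. \<exists>v>0. eval (coloring_oracle f \<oplus> y) test_prog (prod_encode (0, i)) v"
      using eval_test_prog[of f y 0] m(2) by (metis of_bool_eq(2) zero_less_one)
  qed
  then have "eval (coloring_oracle f \<oplus> y) search_prog 0 (list_encode (rev (map y [0..<m])))"
    unfolding search_prog_def
    by (rule eval.eval_Comp[OF eval.eval_Pair[OF eval.eval_Zero] eval_segment_prog])
  with m(1) show thesis using that by blast
qed

text \<open>Column \<open>n\<close> starts with \<open>f n\<close> ones, and the bound 3 leaves room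
  for a 0 after them in the unary part.\<close>

lemma maps_to_coloring_oracle:
  assumes "\<And>n. f n < 3"
  shows "maps_to (prog_index lookup_prog) (coloring_oracle f) f"
proof -
  have "eval (coloring_oracle f) lookup_prog n (f n)" for n
    unfolding lookup_prog_def
  proof (rule eval.eval_Mu)
    have eq: "coloring_oracle f (prod_encode (n, i)) = of_bool (i < f n)" if "i < 3" for i
      using that by (simp add: coloring_oracle_def)
    show "eval (coloring_oracle f) Oracle (prod_encode (n, f n)) 0"
      using eval.eval_Oracle[of "coloring_oracle f" "prod_encode (n, f n)"] eq[OF assms] by simp
    show "\<forall>i<f n. \<exists>v>0. eval (coloring_oracle f) Oracle (prod_encode (n, i)) v"
    proof (intro allI impI)
      fix i assume i: "i < f n"
      then have "i < 3" using assms[of n] by simp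
      from eval.eval_Oracle[of "coloring_oracle f" "prod_encode (n, i)"] eq[OF this] i
      show "\<exists>v>0. eval (coloring_oracle f) Oracle (prod_encode (n, i)) v" by auto
    qed
  qed
  then show ?thesis by (simp add: maps_to_def)
qed

section \<open>Instances built from colorings, and their solutions\<close>

definition coloring_instance :: "(nat \<Rightarrow> nat) \<Rightarrow> nat \<Rightarrow> nat" where
  "coloring_instance f = triple (coloring_oracle f) (prog_index lookup_prog) (prog_index search_prog)"

lemma coloring_instance_cong:
  assumes "\<And>i. i < N \<Longrightarrow> f i = g i" "n < N"
  shows "coloring_instance f n = coloring_instance g n"
proof -
  have "coloring_oracle f i = coloring_oracle g i" if "i < N" for i
    using that assms by (intro coloring_oracle_cong) auto
  with assms(2) show ?thesis
    by (auto simp: coloring_instance_def triple_def split: nat.split)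
qed

text \<open>Solutions of a first-order part refer to some decomposition of the instance; injectivity
  makes it the intended one.\<close>

lemma triple_inject [simp]: "triple A d g = triple B e h \<longleftrightarrow> A = B \<and> d = e \<and> g = h"
proof
  assume eq: "triple A d g = triple B e h"
  have "A n = B n" for n using fun_cong[OF eq, of "Suc (Suc n)"] by (simp add: triple_def)
  with fun_cong[OF eq, of 0] fun_cong[OF eq, of 1] show "A = B \<and> d = e \<and> g = h"
    by (auto simp: triple_def)
qed simp

lemma segment_set_char_fun:
  "segment_set (map (char_fun (str_code ` H)) [0..<n]) = {\<sigma> \<in> H. str_code \<sigma> < n}"
  by (auto simp: segment_set_def char_fun_def inj_image_mem_iff[OF bij_is_inj[OF bij_str_code]] simp del: One_nat_def)

text \<open>This makes the search converge on every solution. A tree of color 0 needs just one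
  point; any other color shows that \<open>f\<close> has a first nonzero position, and the tree has
  antichains of every finite size.\<close>

lemma sufficient_initial_segment:
  assumes H: "perfect_subtree H" "\<And>\<sigma>. \<sigma> \<in> H \<Longrightarrow> f (str_code \<sigma>) = c"
  obtains n where "sufficient f (map (char_fun (str_code ` H)) [0..<n])"
proof (cases "c = 0")
  case True
  obtain \<sigma> where "\<sigma> \<in> H" using perfect_subtree_nonempty[OF H(1)] by blast
  then have "sufficient f (map (char_fun (str_code ` H)) [0..<Suc (str_code \<sigma>)])"
    using H(2) True unfolding sufficient_def segment_set_char_fun by blast
  then show ?thesis using that by blast
next
  case False
  define s where "s = (LEAST s. f s \<noteq> 0)"
  obtain \<sigma> where "\<sigma> \<in> H" using perfect_subtree_nonempty[OF H(1)] by blast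
  then have "f (str_code \<sigma>) \<noteq> 0" using H(2) False by simp
  then have s: "f s \<noteq> 0" "\<forall>t<s. f t = 0"
    unfolding s_def by (auto intro: LeastI dest: not_less_Least)
  obtain F where F: "F \<subseteq> H" "finite F" "pairwise (\<parallel>) F" "s \<le> card F"
    using perfect_subtree_antichain[OF H(1)] by blast
  define n where "n = Suc (Max (insert s (str_code ` F)))"
  have "s < n" "\<sigma> \<in> F \<Longrightarrow> str_code \<sigma> < n" for \<sigma>
    using F(2) by (simp_all add: n_def less_Suc_eq_le)
  then have "sufficient f (map (char_fun (str_code ` H)) [0..<n])"
    unfolding sufficient_def segment_set_char_fun using s F
    by (intro disjI2 exI[of _ s] conjI exI[of _ F]) auto
  then show ?thesis using that by blast
qed

lemma coloring_instance_in_instances: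
  assumes "k \<ge> 3" "\<And>n. f n < 3"
  shows "coloring_instance f \<in> instances (first_order_part (TT1 k))"
proof -
  have "coloring_oracle f p = 0 \<or> coloring_oracle f p = 1" for p
    by (cases "prod_decode p") (simp add: coloring_oracle_def)
  then have range: "range (coloring_oracle f) \<subseteq> {0, 1}" by (metis image_subset_iff insertCI)
  have inst: "f \<in> instances (TT1 k)"
    using assms by (auto simp: TT1_def intro: order.strict_trans2)
  have conv: "\<exists>v. converges (prog_index search_prog) (coloring_oracle f \<oplus> y) 0 v"
    if "y \<in> solutions (TT1 k) f" for y
    using that unfolding TT1_def
    by simp (metis sufficient_initial_segment eval_search_prog)
  have maps: "maps_to (prog_index lookup_prog) (coloring_oracle f) f"
    by (rule maps_to_coloring_oracle) (rule assms(2))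
  show ?thesis
    unfolding first_order_part_def coloring_instance_def problem.simps mem_Collect_eq
    by (rule exI, rule exI, rule exI, rule conjI, rule refl)
      (intro conjI bexI[of _ f] ballI range inst conv maps)
qed

text \<open>The later argument refutes a value by showing that its segment is not sufficient or does
  not extend to a homogeneous perfect subtree.\<close>

lemma coloring_instance_solution:
  assumes "\<And>n. f n < 3" "w \<in> solutions (first_order_part (TT1 k)) (coloring_instance f)"
  obtains H c where "perfect_subtree H" "\<And>\<sigma>. \<sigma> \<in> H \<Longrightarrow> f (str_code \<sigma>) = c"
    "segment_set (rev (list_decode (w 0))) \<subseteq> H" "sufficient f (rev (list_decode (w 0)))"
proof -
  from assms(2) obtain z y v where v: "w = const_seq v"
    "maps_to (prog_index lookup_prog) (coloring_oracle f) z"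
    "y \<in> solutions (TT1 k) z" "eval (coloring_oracle f \<oplus> y) search_prog 0 v"
    by (auto simp: first_order_part_def coloring_instance_def)
  have "z = f" by (rule maps_to_unique[OF v(2) maps_to_coloring_oracle[OF assms(1)]])
  with v(3) obtain H c where H: "y = char_fun (str_code ` H)" "perfect_subtree H"
      "\<And>\<sigma>. \<sigma> \<in> H \<Longrightarrow> f (str_code \<sigma>) = c"
    by (auto simp: TT1_def)
  from sufficient_initial_segment[of H f c, OF H(2,3)] eval_search_prog obtain m where
    m: "sufficient f (map y [0..<m])"
      "eval (coloring_oracle f \<oplus> y) search_prog 0 (list_encode (rev (map y [0..<m])))"
    unfolding H(1) by metis
  have "rev (list_decode (w 0)) = map y [0..<m]"
    using eval_deterministic[OF v(4) m(2)] v(1) by (simp add: const_seq_def)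
  with m(1) H show thesis
    using that[of H c] by (auto simp: segment_set_char_fun)
qed


section \<open>Defeating finitely many guesses\<close>

text \<open>Fixing the first nonzero position fixes the antichain size demanded by
  \<open>sufficient\<close>.\<close>

definition late_colorings :: "nat \<Rightarrow> (nat \<Rightarrow> nat) set" where
  "late_colorings s = {f. (\<forall>n. f n < 3) \<and> (\<forall>t<s. f t = 0) \<and> f s \<noteq> 0}"

text \<open>Once color 0 is avoided far out, only guesses with an antichain of size \<open>s\<close>
  survive. As \<open>card C <= s\<close>, these have pairwise incomparable representatives, whose
  cones can be colored independently.\<close>

lemma defeat_guesses:
  fixes v :: "'i \<Rightarrow> nat"
  assumes f: "f \<in> late_colorings s" and C: "finite C" "card C \<le> s"
  obtains g where "g \<in> late_colorings s" "\<And>i. i < N \<Longrightarrow> g i = f i"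
    "\<And>c w. c \<in> C \<Longrightarrow> w \<in> solutions (first_order_part (TT1 k)) (coloring_instance g) \<Longrightarrow> w 0 \<noteq> v c"
proof -
  define D where "D c = segment_set (rev (list_decode (v c)))" for c
  define live where "live = {c \<in> C. \<exists>F \<subseteq> D c. pairwise (\<parallel>) F \<and> s \<le> card F}"
  have "\<forall>c\<in>live. \<exists>F. F \<subseteq> D c \<and> pairwise (\<parallel>) F \<and> s \<le> card F"
    by (auto simp: live_def)
  then obtain F where F: "\<And>c. c \<in> live \<Longrightarrow> F c \<subseteq> D c \<and> pairwise (\<parallel>) (F c) \<and> s \<le> card (F c)"
    by metis
  have live: "finite live" "card live \<le> s"
    using C by (auto simp: live_def intro: order.trans[OF card_mono])
  have "finite (F c) \<and> pairwise (\<parallel>) (F c) \<and> card live \<le> card (F c)" if "c \<in> live" for c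
    using F[OF that] live(2) finite_subset[OF _ finite_segment_set] unfolding D_def by auto
  from incomparable_representatives[where F = F, OF live(1) this] obtain r where
    r: "\<And>c. c \<in> live \<Longrightarrow> r c \<in> D c" "pairwise (\<lambda>c d. r c \<parallel> r d) live"
    using F by blast
  \<comment> \<open>Changes from \<open>M\<close> on preserve the agreement below \<open>N\<close>,
    the first nonzero position \<open>s\<close> and the colors of the representatives.\<close>
  define M where "M = Max (insert N (insert (Suc s) ((\<lambda>c. Suc (str_code (r c))) ` live)))"
  have M: "N \<le> M" "Suc s \<le> M" "c \<in> live \<Longrightarrow> Suc (str_code (r c)) \<le> M" for c
    unfolding M_def by (rule Max_ge; use live(1) in auto)+
  \<comment> \<open>Cones over representatives of color 1 get color 2. The default color 1 elsewhere
    defeats representatives of color 2, since by incomparability their cones avoid the former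
    ones.\<close>
  define above where "above n = (\<exists>c\<in>live. f (str_code (r c)) = 1 \<and> prefix (r c) (inv str_code n))" for n
  define g where "g n = (if n < M then f n else if above n then 2 else 1)" for n
  have g: "g \<in> late_colorings s"
    using f M(2) by (auto simp: late_colorings_def g_def)
  moreover have "g i = f i" if "i < N" for i
    using that M(1) by (simp add: g_def)
  moreover have "w 0 \<noteq> v c"
    if c: "c \<in> C" and w: "w \<in> solutions (first_order_part (TT1 k)) (coloring_instance g)" for c w
  proof
    assume wv: "w 0 = v c"
    have "\<And>n. g n < 3" using g by (simp add: late_colorings_def)
    from coloring_instance_solution[OF this w] obtain H i where
      H: "perfect_subtree H" "\<And>\<sigma>. \<sigma> \<in> H \<Longrightarrow> g (str_code \<sigma>) = i" "D c \<subseteq> H"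
      and suff: "sufficient g (rev (list_decode (v c)))"
      unfolding wv D_def by blast
    have far: "\<exists>\<tau>\<in>H. prefix \<sigma> \<tau> \<and> M \<le> str_code \<tau>" if "\<sigma> \<in> H" for \<sigma>
      using infinite_strings_above_code[OF perfect_subtree_infinite_above[OF H(1) that]] by blast
    \<comment> \<open>Every perfect subtree has points coded beyond \<open>M\<close>, where
      \<open>g\<close> avoids 0.\<close>
    obtain \<tau> where "\<tau> \<in> H" "M \<le> str_code \<tau>" using far perfect_subtree_nonempty[OF H(1)] by blast
    then have "i \<noteq> 0" using H(2)[of \<tau>] by (auto simp: g_def split: if_splits)
    then have nonzero: "\<And>\<sigma>. \<sigma> \<in> D c \<Longrightarrow> g (str_code \<sigma>) \<noteq> 0" using H(2,3) by auto
    obtain t F where "g t \<noteq> 0" "\<forall>u<t. g u = 0" "F \<subseteq> D c" "pairwise (\<parallel>) F" "t \<le> card F"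
      using suff nonzero unfolding sufficient_def D_def[symmetric] by auto
    moreover have "t = s" if "g t \<noteq> 0" "\<forall>u<t. g u = 0"
      using g that by (metis (mono_tags, lifting) late_colorings_def linorder_neqE_nat mem_Collect_eq)
    ultimately have cl: "c \<in> live" using c by (auto simp: live_def)
    then have rH: "r c \<in> H" using r(1) H(3) by blast
    from far[OF this] obtain \<tau> where \<tau>: "\<tau> \<in> H" "prefix (r c) \<tau>" "M \<le> str_code \<tau>" by blast
    have fi: "f (str_code (r c)) = i"
      using H(2)[OF rH] M(3)[OF cl] by (simp add: g_def)
    have inv: "inv str_code (str_code \<tau>) = \<tau>" by (simp add: bij_is_inj[OF bij_str_code])
    \<comment> \<open>So the color of \<open>\<tau>\<close> is 2 if \<open>r c\<close> has color 1,
      and 1 otherwise: it never equals \<open>i\<close>.\<close>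
    have "above (str_code \<tau>) \<longleftrightarrow> i = 1"
    proof
      assume "above (str_code \<tau>)"
      then obtain d where d: "d \<in> live" "f (str_code (r d)) = 1" "prefix (r d) \<tau>"
        by (auto simp: above_def inv)
      have "d = c"
        using d cl \<tau>(2) r(2) by (metis pairwiseD parallelE prefix_same_cases)
      with d fi show "i = 1" by simp
    next
      assume "i = 1"
      with fi cl \<tau>(2) show "above (str_code \<tau>)" by (auto simp: above_def inv)
    qed
    with H(2)[OF \<tau>(1)] \<tau>(3) show False by (auto simp: g_def split: if_splits)
  qed
  ultimately show thesis by (rule that)
qed


section \<open>Committing the columns one after another\<close>

theorem theorem4p6:
  fixes k :: nat
  assumes "k \<ge> 3"
  shows "\<not> first_order_part (TT1 k) \<le>\<^sub>W RT1_plus"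
proof
  let ?P = "first_order_part (TT1 k)" and ?x = coloring_instance
  assume "?P \<le>\<^sub>W RT1_plus"
  then obtain \<Phi> \<Psi> where red: "\<And>x. x \<in> instances ?P \<Longrightarrow> \<exists>z \<in> instances RT1_plus. maps_to \<Phi> x z \<and>
        (\<forall>y \<in> solutions RT1_plus z. \<exists>w \<in> solutions ?P x. maps_to \<Psi> (x \<oplus> y) w)"
    unfolding weihrauch_le_def by blast
  then have "\<exists>z \<in> instances RT1_plus. maps_to \<Phi> (?x f) z \<and>
        (\<forall>y \<in> solutions RT1_plus z. \<exists>w \<in> solutions ?P (?x f). maps_to \<Psi> (?x f \<oplus> y) w)"
    if "\<forall>n. f n < 3" for f
    using coloring_instance_in_instances[OF assms] that by blast
  then obtain Z where Z: "\<And>f. \<forall>n. f n < 3 \<Longrightarrow> Z f \<in> instances RT1_plus"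
    "\<And>f. \<forall>n. f n < 3 \<Longrightarrow> maps_to \<Phi> (?x f) (Z f)"
    "\<And>f y. \<forall>n. f n < 3 \<Longrightarrow> y \<in> solutions RT1_plus (Z f) \<Longrightarrow>
       \<exists>w \<in> solutions ?P (?x f). maps_to \<Psi> (?x f \<oplus> y) w"
    by metis
  \<comment> \<open>Although \<open>Z\<close> comes from choice, each \<open>Z f\<close> is computed
    from the instance of \<open>f\<close>, so it depends continuously on \<open>f\<close>.\<close>
  have Z_local: "\<exists>U. \<forall>g. (\<forall>n. g n < 3) \<longrightarrow> (\<forall>i<U. g i = f i) \<longrightarrow> (\<forall>n<N. Z g n = Z f n)"
    if f: "\<forall>n. f n < 3" for f N
  proof -
    from maps_to_continuous[OF Z(2)[OF f], of N] obtain U where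
      U: "\<And>Y n. (\<And>i. i < U \<Longrightarrow> Y i = ?x f i) \<Longrightarrow> n < N \<Longrightarrow> converges \<Phi> Y n (Z f n)" by blast
    have "Z g n = Z f n" if "\<forall>n. g n < 3" "\<forall>i<U. g i = f i" "n < N" for g n
    proof (rule converges_deterministic)
      show "converges \<Phi> (?x g) n (Z g n)" using Z(2)[OF that(1)] by (simp add: maps_to_def)
      show "converges \<Phi> (?x g) n (Z f n)"
        using that by (intro U coloring_instance_cong) auto
    qed
    then show ?thesis by blast
  qed
  \<comment> \<open>The number of columns announced for the constantly 0 coloring.\<close>
  define j where "j = Z (\<lambda>_. 0) 0"
  from Z_local[of "\<lambda>_. 0" 1] obtain U0 where
    U0: "\<And>g. \<forall>n. g n < 3 \<Longrightarrow> \<forall>i<U0. g i = 0 \<Longrightarrow> Z g 0 = j"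
    by (auto simp: j_def)
  \<comment> \<open>\<open>U0 <= s\<close> keeps the announcement \<open>j\<close> valid for all
    late colorings; \<open>j <= s\<close> lets \<open>defeat_guesses\<close> refute up to
    \<open>j\<close> guesses at once.\<close>
  define s where "s = max U0 j"
  let ?L = "late_colorings s"
  have L3: "\<forall>n. f n < 3" if "f \<in> ?L" for f using that by (simp add: late_colorings_def)
  have Zj: "Z f 0 = j" if "f \<in> ?L" for f
    using U0 that by (simp add: late_colorings_def s_def)
  \<comment> \<open>Given an infinite column \<open>c\<close>, the solver answers \<open>v\<close>
    after reading finitely much, so \<open>v\<close> stays correct as long as the column remains
    infinite. Refuting \<open>v\<close> thus forces the column to be finite.\<close>
  define guess where "guess f N c v \<longleftrightarrow> (\<forall>g\<in>?L. (\<forall>i<N. g i = f i) \<longrightarrow> infinite {n. Z g (Suc n) = c} \<longrightarrow>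
      (\<exists>w \<in> solutions ?P (?x g). w 0 = v))" for f N c v
  have guess_mono: "guess g M c v" if "guess f N c v" "\<forall>i<N. g i = f i" "N \<le> M" for f g N M c v
    using that unfolding guess_def by (metis order.strict_trans2)
  \<comment> \<open>Each round refutes all committed values, so an infinite column must be a new one
    and gets committed too. Reaching \<open>j + 1\<close> columns is absurd.\<close>
  have "\<exists>C \<subseteq> {..<j}. card C = m \<and> (\<exists>f\<in>?L. \<exists>N v. \<forall>c\<in>C. guess f N c (v c))" if "m \<le> Suc j" for m
    using that
  proof (induction m)
    case 0
    have "(\<lambda>n. if n < s then 0 else 1) \<in> ?L" by (auto simp: late_colorings_def)
    then show ?case by (intro exI[of _ "{}"]) auto
  next
    case (Suc m)
    then obtain C where C: "C \<subseteq> {..<j}" "card C = m"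
      and ex: "\<exists>f\<in>?L. \<exists>N v. \<forall>c\<in>C. guess f N c (v c)" by (meson Suc_leD)
    from ex obtain f N v where f: "f \<in> ?L" and v: "\<And>c. c \<in> C \<Longrightarrow> guess f N c (v c)" by blast
    have "finite C" using C(1) finite_subset by blast
    have "card C \<le> s" using Suc.prems C(2) by (simp add: s_def)
    obtain g where g: "g \<in> ?L" "\<And>i. i < N \<Longrightarrow> g i = f i"
      "\<And>c w. c \<in> C \<Longrightarrow> w \<in> solutions ?P (?x g) \<Longrightarrow> w 0 \<noteq> v c"
      by (rule defeat_guesses[OF f \<open>finite C\<close> \<open>card C \<le> s\<close>, of N k v]) (rule that)
    have g3: "\<forall>n. g n < 3" using L3 g(1) .
    have col: "Z g (Suc n) < j" for n
    proof -
      obtain i h where "Z g = case_nat i h" "\<forall>n. h n < i"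
        using Z(1)[OF g3] unfolding RT1_plus_def by auto
      with Zj[OF g(1)] show ?thesis by simp
    qed
    then have "finite (range (\<lambda>n. Z g (Suc n)))"
      by (intro finite_subset[OF _ finite_lessThan]) auto
    then obtain n0 where "infinite {n. Z g (Suc n) = Z g (Suc n0)}"
      using pigeonhole_infinite[of UNIV "\<lambda>n. Z g (Suc n)"] by auto
    moreover define d where "d = Z g (Suc n0)"
    ultimately have inf: "infinite {n. Z g (Suc n) = d}" by simp
    have "d < j" using col by (simp add: d_def)
    \<comment> \<open>Otherwise \<open>v d\<close> would be correct for \<open>g\<close>, since
      column \<open>d\<close> is infinite.\<close>
    have "d \<notin> C"
      using v g inf unfolding guess_def by blast
    let ?M = "{n. Z g (Suc n) = d}"
    have "char_fun ?M \<in> solutions RT1_plus (Z g)"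
      using inf by (auto simp: RT1_plus_def)
    from Z(3)[OF g3 this] obtain w where w: "maps_to \<Psi> (?x g \<oplus> char_fun ?M) w" by blast
    then obtain U where U: "\<And>Y. (\<And>i. i < U \<Longrightarrow> Y i = (?x g \<oplus> char_fun ?M) i) \<Longrightarrow> converges \<Psi> Y 0 (w 0)"
      unfolding maps_to_def using converges_continuous by metis
    \<comment> \<open>Entry 0 of \<open>Z g\<close> is \<open>j\<close>, so its first
      \<open>U\<close> colors are the entries from 1 to \<open>U\<close>.\<close>
    from Z_local[OF g3, of "Suc U"] obtain V where
      V: "\<And>h n. \<forall>n. h n < 3 \<Longrightarrow> \<forall>i<V. h i = g i \<Longrightarrow> n < Suc U \<Longrightarrow> Z h n = Z g n" by blast
    \<comment> \<open>\<open>N\<close> preserves the old commitments, while \<open>U\<close> and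
      \<open>V\<close> fix the instance and column \<open>d\<close> as far as \<open>\<Psi>\<close>
      reads them.\<close>
    define N' where "N' = max N (max U V)"
    have "guess g N' d (w 0)"
      unfolding guess_def
    proof (intro ballI impI)
      fix h assume h: "h \<in> ?L" "\<forall>i<N'. h i = g i" "infinite {n. Z h (Suc n) = d}"
      have "char_fun {n. Z h (Suc n) = d} \<in> solutions RT1_plus (Z h)"
        using h(3) by (auto simp: RT1_plus_def)
      from Z(3)[OF L3[OF h(1)] this] obtain u where u: "u \<in> solutions ?P (?x h)"
        "maps_to \<Psi> (?x h \<oplus> char_fun {n. Z h (Suc n) = d}) u" by blast
      have "converges \<Psi> (?x h \<oplus> char_fun {n. Z h (Suc n) = d}) 0 (w 0)"
      proof (rule U)
        fix i assume i: "i < U"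
        have "Z h (Suc (i div 2)) = Z g (Suc (i div 2))"
          using h(2) i by (intro V L3 h(1)) (auto simp: N'_def)
        moreover have "?x h (i div 2) = ?x g (i div 2)"
          using h(2) i by (intro coloring_instance_cong[of N']) (auto simp: N'_def)
        ultimately show "(?x h \<oplus> char_fun {n. Z h (Suc n) = d}) i = (?x g \<oplus> char_fun ?M) i"
          by (simp add: join_def char_fun_def)
      qed
      with u(2) have "u 0 = w 0"
        unfolding maps_to_def by (metis converges_deterministic)
      with u(1) show "\<exists>w' \<in> solutions ?P (?x h). w' 0 = w 0" by blast
    qed
    moreover have "guess g N' c (v c)" if "c \<in> C" for c
      using guess_mono[OF v[OF that]] g(2) by (simp add: N'_def)
    ultimately have "\<forall>c\<in>insert d C. guess g N' c ((v(d := w 0)) c)" by auto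
    moreover have "insert d C \<subseteq> {..<j}" "card (insert d C) = Suc m"
      using C \<open>d < j\<close> \<open>d \<notin> C\<close> \<open>finite C\<close> by auto
    ultimately show ?case using g(1) by blast
  qed
  then obtain C where "C \<subseteq> {..<j}" "card C = Suc j" by blast
  then show False using card_mono[of "{..<j}" C] by simp
qed

end
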